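(* Let $C$ be a braided bimonoidal category. Then its bimonoidal symmetric center $C^{\mathsf{sym}}$, i.e. the full subcategory of objects $A\in C$ such that $\zeta^\otimes_{B,A}\zeta^\otimes_{A,B}=1_{A\otimes B}$ for all $B\in C$, with the structure restricted from $C$, is a symmetric bimonoidal category.
   Context: Write $AB$ for $A\otimes B$; $\otimes$ binds tighter than $\oplus$. A bimonoidal category is a category $C$ with a symmetric monoidal structure $(\oplus,0,\alpha^\oplus,\lambda^\oplus,\rho^\oplus,\zeta^\oplus)$, a monoidal structure $(\otimes,1,\alpha^\otimes,\lambda^\otimes,\rho^\otimes)$ (with $\alpha_{A,B,C}:(AB)C\to A(BC)$, $\lambda_A$, $\rho_A$ the left/right unit isomorphisms), natural isomorphisms $\lambda^\bullet_A:0A\to0$, $\rho^\bullet_A:A0\to 0$, and natural monomorphisms $\delta^l_{A,B,C}:A(B\oplus C)\to AB\oplus AC$, $\delta^r_{A,B,C}:(A\oplus B)C\to AC\oplus BC$, such that for all objects: $\delta^l_{A,C,B}(1\otimes\zeta^\oplus_{B,C})=\zeta^\oplus_{AB,AC}\delta^l_{A,B,C}$; $\delta^r_{B,A,C}(\zeta^\oplus_{A,B}\otimes1)=\zeta^\oplus_{AC,BC}\delta^r_{A,B,C}$; $\alpha^\oplus(\delta^r_{A,B,D}\oplus1)\delta^r_{A\oplus B,C,D}=(1\oplus\delta^r_{B,C,D})\delta^r_{A,B\oplus C,D}(\alpha^\oplus_{A,B,C}\otimes1)$; $\alpha^\oplus(\delta^l_{A,B,C}\oplus1)\delta^l_{A,B\oplus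 C,D}=(1\oplus\delta^l_{A,C,D})\delta^l_{A,B,C\oplus D}(1\otimes\alpha^\oplus_{B,C,D})$; $\delta^l_{A,BC,BD}(1\otimes\delta^l_{B,C,D})\alpha^\otimes_{A,B,C\oplus D}=(\alpha^\otimes_{A,B,C}\oplus\alpha^\otimes_{A,B,D})\delta^l_{AB,C,D}$; $(\alpha^\otimes_{A,C,D}\oplus\alpha^\otimes_{B,C,D})\delta^r_{AC,BC,D}(\delta^r_{A,B,C}\otimes1)=\delta^r_{A,B,CD}\alpha^\otimes_{A\oplus B,C,D}$; $(\alpha^\otimes_{A,B,D}\oplus\alpha^\otimes_{A,C,D})\delta^r_{AB,AC,D}(\delta^l_{A,B,C}\otimes1)=\delta^l_{A,BD,CD}(1\otimes\delta^r_{B,C,D})\alpha^\otimes_{A,B\oplus C,D}$; $\mu(\delta^l_{A,C,D}\oplus\delta^l_{B,C,D})\delta^r_{A,B,C\oplus D}=(\delta^r_{A,B,C}\oplus\delta^r_{A,B,D})\delta^l_{A\oplus B,C,D}$, where $\mu:(AC\oplus AD)\oplus(BC\oplus BD)\to(AC\oplus BC)\oplus(AD\oplus BD)$ is the coherence isomorphism exchanging the two middle summands; $\lambda^\bullet_0=\rho^\bullet_0$; $\lambda^\oplus_0(\lambda^\bullet_A\oplus\lambda^\bullet_B)\delta^l_{0,A,B}=\lambda^\bullet_{A\oplus B}$; $\lambda^\oplus_0(\rho^\bullet_A\oplus\rho^\bullet_B)\delta^r_{A,B,0}=\rho^\bullet_{A\oplus B}$; $\rho^\otimes_0=\lambda^\bullet_1$;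 $\lambda^\otimes_0=\rho^\bullet_1$; $\lambda^\bullet_{AB}\alpha^\otimes_{0,A,B}=\lambda^\bullet_B(\lambda^\bullet_A\otimes1)$; $\rho^\bullet_A(1\otimes\lambda^\bullet_B)\alpha^\otimes_{A,0,B}=\lambda^\bullet_B(\rho^\bullet_A\otimes1)$; $\rho^\bullet_A(1\otimes\rho^\bullet_B)\alpha^\otimes_{A,B,0}=\rho^\bullet_{AB}$; $\lambda^\oplus_{AB}(\rho^\bullet_A\oplus1)\delta^l_{A,0,B}=1\otimes\lambda^\oplus_B$; $\lambda^\oplus_{BA}(\lambda^\bullet_A\oplus1)\delta^r_{0,B,A}=\lambda^\oplus_B\otimes1$; $\rho^\oplus_{AB}(1\oplus\rho^\bullet_A)\delta^l_{A,B,0}=1\otimes\rho^\oplus_B$; $\rho^\oplus_{AB}(1\oplus\lambda^\bullet_B)\delta^r_{A,0,B}=\rho^\oplus_A\otimes1$; $(\lambda^\otimes_A\oplus\lambda^\otimes_B)\delta^l_{1,A,B}=\lambda^\otimes_{A\oplus B}$; $(\rho^\otimes_A\oplus\rho^\otimes_B)\delta^r_{A,B,1}=\rho^\otimes_{A\oplus B}$. A braided bimonoidal category is a bimonoidal category with a braiding $\zeta^\otimes$ making $\otimes$ braided monoidal, such that $\delta^l_{C,A,B}\zeta^\otimes_{A\oplus B,C}=(\zeta^\otimes_{A,C}\oplus\zeta^\otimes_{B,C})\delta^r_{A,B,C}$, $\delta^r_{B,C,A}\zeta^\otimes_{A,B\oplus C}=(\zeta^\otimes_{A,B}\oplus\zeta^\otimes_{A,C})\delta^l_{A,B,C}$,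 $\lambda^\bullet_A\zeta^\otimes_{A,0}=\rho^\bullet_A$, and $\rho^\bullet_A\zeta^\otimes_{0,A}=\lambda^\bullet_A$. A symmetric bimonoidal category is a braided bimonoidal category with $\zeta^\otimes_{B,A}\zeta^\otimes_{A,B}=1$ for all objects $A,B$. *)

theory Defs
  imports Main
begin

section \<open>Categories\<close>

text \<open>
  A category consists of a set of objects and a set of arrows in two arbitrary types. All operations
  are total functions of the logic; the axioms constrain them on objects and arrows only.
\<close>

record ('o, 'm) cat_data =
  Obj :: "'o set"
  Arr :: "'m set"
  Dom :: "'m \<Rightarrow> 'o"
  Cod :: "'m \<Rightarrow> 'o"
  Id :: "'o \<Rightarrow> 'm"  ("\<one>\<index>")
  Comp :: "'m \<Rightarrow> 'm \<Rightarrow> 'm"  (infixr "\<cdot>\<index>" 55)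

definition hom :: "('o, 'm, 'x) cat_data_scheme \<Rightarrow> 'o \<Rightarrow> 'o \<Rightarrow> 'm set" where
  "hom C A B = {f \<in> Arr C. Dom C f = A \<and> Cod C f = B}"

locale category =
  fixes C :: "('o, 'm, 'x) cat_data_scheme" (structure)
  assumes dom_closed: "f \<in> Arr C \<Longrightarrow> Dom C f \<in> Obj C"
    and cod_closed: "f \<in> Arr C \<Longrightarrow> Cod C f \<in> Obj C"
    and id_closed: "A \<in> Obj C \<Longrightarrow> \<one> A \<in> hom C A A"
    and comp_closed: "f \<in> hom C A B \<Longrightarrow> g \<in> hom C B D \<Longrightarrow> g \<cdot> f \<in> hom C A D"
    and id_left: "f \<in> hom C A B \<Longrightarrow> \<one> B \<cdot> f = f"
    and id_right: "f \<in> hom C A B \<Longrightarrow> f \<cdot> \<one> A = f"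
    and comp_assoc: "f \<in> hom C A B \<Longrightarrow> g \<in> hom C B D \<Longrightarrow> h \<in> hom C D E \<Longrightarrow>
      (h \<cdot> g) \<cdot> f = h \<cdot> (g \<cdot> f)"

definition is_inverse :: "('o, 'm, 'x) cat_data_scheme \<Rightarrow> 'm \<Rightarrow> 'm \<Rightarrow> bool" where
  "is_inverse C f g \<longleftrightarrow> g \<in> hom C (Cod C f) (Dom C f) \<and>
     g \<cdot>\<^bsub>C\<^esub> f = \<one>\<^bsub>C\<^esub> (Dom C f) \<and> f \<cdot>\<^bsub>C\<^esub> g = \<one>\<^bsub>C\<^esub> (Cod C f)"

definition iso_arrs :: "('o, 'm, 'x) cat_data_scheme \<Rightarrow> 'o \<Rightarrow> 'o \<Rightarrow> 'm set" where
  "iso_arrs C A B = {f \<in> hom C A B. \<exists>g. is_inverse C f g}"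

definition inverse_arr :: "('o, 'm, 'x) cat_data_scheme \<Rightarrow> 'm \<Rightarrow> 'm"  ("inv\<index> _" [81] 80) where
  "inv\<^bsub>C\<^esub> f = (THE g. is_inverse C f g)"

definition mono_arrs :: "('o, 'm, 'x) cat_data_scheme \<Rightarrow> 'o \<Rightarrow> 'o \<Rightarrow> 'm set" where
  "mono_arrs C A B = {f \<in> hom C A B. \<forall>X \<in> Obj C. \<forall>g \<in> hom C X A. \<forall>h \<in> hom C X A.
     f \<cdot>\<^bsub>C\<^esub> g = f \<cdot>\<^bsub>C\<^esub> h \<longrightarrow> g = h}"

text \<open>
  Extension fields of the record are left untouched: any further structure on \<open>C\<close> is restricted to
  the new objects and arrows, and nothing is said here about these being closed under it.
\<close>

definition full_subcategory ::
    "('o, 'm, 'x) cat_data_scheme \<Rightarrow> 'o set \<Rightarrow> ('o, 'm, 'x) cat_data_scheme" where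
  "full_subcategory C S = C\<lparr>Obj := S, Arr := {f \<in> Arr C. Dom C f \<in> S \<and> Cod C f \<in> S}\<rparr>"


section \<open>Monoidal, braided and symmetric monoidal structures\<close>

text \<open>
  A tensor product is given separately on objects (\<open>\<otimes>\<close>) and on arrows (\<open>\<otimes>\<^sub>m\<close>).
\<close>

locale monoidal_category = category C
  for C :: "('o, 'm, 'x) cat_data_scheme" (structure) +
  fixes tobj :: "'o \<Rightarrow> 'o \<Rightarrow> 'o"  (infixl "\<otimes>" 70)
    and tarr :: "'m \<Rightarrow> 'm \<Rightarrow> 'm"  (infixl "\<otimes>\<^sub>m" 70)
    and I :: 'o
    and \<alpha> :: "'o \<Rightarrow> 'o \<Rightarrow> 'o \<Rightarrow> 'm"
    and l :: "'o \<Rightarrow> 'm"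
    and r :: "'o \<Rightarrow> 'm"
  assumes tobj_closed: "A \<in> Obj C \<Longrightarrow> B \<in> Obj C \<Longrightarrow> A \<otimes> B \<in> Obj C"
    and tarr_closed: "f \<in> hom C A A' \<Longrightarrow> g \<in> hom C B B' \<Longrightarrow> f \<otimes>\<^sub>m g \<in> hom C (A \<otimes> B) (A' \<otimes> B')"
    and tarr_id: "A \<in> Obj C \<Longrightarrow> B \<in> Obj C \<Longrightarrow> \<one> A \<otimes>\<^sub>m \<one> B = \<one> (A \<otimes> B)"
    and tarr_comp: "f \<in> hom C A A' \<Longrightarrow> f' \<in> hom C A' A'' \<Longrightarrow> g \<in> hom C B B' \<Longrightarrow> g' \<in> hom C B' B'' \<Longrightarrow>
      (f' \<cdot> f) \<otimes>\<^sub>m (g' \<cdot> g) = (f' \<otimes>\<^sub>m g') \<cdot> (f \<otimes>\<^sub>m g)"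
    and unit_closed: "I \<in> Obj C"
    and assoc_iso: "A \<in> Obj C \<Longrightarrow> B \<in> Obj C \<Longrightarrow> D \<in> Obj C \<Longrightarrow>
      \<alpha> A B D \<in> iso_arrs C ((A \<otimes> B) \<otimes> D) (A \<otimes> (B \<otimes> D))"
    and assoc_natural: "f \<in> hom C A A' \<Longrightarrow> g \<in> hom C B B' \<Longrightarrow> h \<in> hom C D D' \<Longrightarrow>
      \<alpha> A' B' D' \<cdot> ((f \<otimes>\<^sub>m g) \<otimes>\<^sub>m h) = (f \<otimes>\<^sub>m (g \<otimes>\<^sub>m h)) \<cdot> \<alpha> A B D"
    and lunit_iso: "A \<in> Obj C \<Longrightarrow> l A \<in> iso_arrs C (I \<otimes> A) A"
    and lunit_natural: "f \<in> hom C A A' \<Longrightarrow> l A' \<cdot> (\<one> I \<otimes>\<^sub>m f) = f \<cdot> l A"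
    and runit_iso: "A \<in> Obj C \<Longrightarrow> r A \<in> iso_arrs C (A \<otimes> I) A"
    and runit_natural: "f \<in> hom C A A' \<Longrightarrow> r A' \<cdot> (f \<otimes>\<^sub>m \<one> I) = f \<cdot> r A"
    and pentagon: "A \<in> Obj C \<Longrightarrow> B \<in> Obj C \<Longrightarrow> D \<in> Obj C \<Longrightarrow> E \<in> Obj C \<Longrightarrow>
      (\<one> A \<otimes>\<^sub>m \<alpha> B D E) \<cdot> \<alpha> A (B \<otimes> D) E \<cdot> (\<alpha> A B D \<otimes>\<^sub>m \<one> E) = \<alpha> A B (D \<otimes> E) \<cdot> \<alpha> (A \<otimes> B) D E"
    and triangle: "A \<in> Obj C \<Longrightarrow> B \<in> Obj C \<Longrightarrow> (\<one> A \<otimes>\<^sub>m l B) \<cdot> \<alpha> A I B = r A \<otimes>\<^sub>m \<one> B"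

text \<open>
  A braiding is a natural isomorphism subject to the two hexagons of Joyal and Street; its
  compatibility with the unit isomorphisms is a consequence of these and not an axiom.
\<close>

locale braided_monoidal_category = monoidal_category C tobj tarr I \<alpha> l r
  for C :: "('o, 'm, 'x) cat_data_scheme" (structure)
    and tobj (infixl "\<otimes>" 70)
    and tarr (infixl "\<otimes>\<^sub>m" 70)
    and I \<alpha> l r +
  fixes \<zeta> :: "'o \<Rightarrow> 'o \<Rightarrow> 'm"
  assumes braid_iso: "A \<in> Obj C \<Longrightarrow> B \<in> Obj C \<Longrightarrow> \<zeta> A B \<in> iso_arrs C (A \<otimes> B) (B \<otimes> A)"
    and braid_natural: "f \<in> hom C A A' \<Longrightarrow> g \<in> hom C B B' \<Longrightarrow>
      \<zeta> A' B' \<cdot> (f \<otimes>\<^sub>m g) = (g \<otimes>\<^sub>m f) \<cdot> \<zeta> A B"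
    and hexagon_right: "A \<in> Obj C \<Longrightarrow> B \<in> Obj C \<Longrightarrow> D \<in> Obj C \<Longrightarrow>
      \<alpha> B D A \<cdot> \<zeta> A (B \<otimes> D) \<cdot> \<alpha> A B D = (\<one> B \<otimes>\<^sub>m \<zeta> A D) \<cdot> \<alpha> B A D \<cdot> (\<zeta> A B \<otimes>\<^sub>m \<one> D)"
    and hexagon_left: "A \<in> Obj C \<Longrightarrow> B \<in> Obj C \<Longrightarrow> D \<in> Obj C \<Longrightarrow>
      inv (\<alpha> D A B) \<cdot> \<zeta> (A \<otimes> B) D \<cdot> inv (\<alpha> A B D) =
      (\<zeta> A D \<otimes>\<^sub>m \<one> B) \<cdot> inv (\<alpha> A D B) \<cdot> (\<one> A \<otimes>\<^sub>m \<zeta> B D)"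

locale symmetric_monoidal_category = braided_monoidal_category +
  assumes symmetry: "A \<in> Obj C \<Longrightarrow> B \<in> Obj C \<Longrightarrow> \<zeta> B A \<cdot> \<zeta> A B = \<one> (A \<otimes> B)"


section \<open>Bimonoidal categories\<close>

record ('o, 'm) bimonoidal_data = "('o, 'm) cat_data" +
  sum_obj :: "'o \<Rightarrow> 'o \<Rightarrow> 'o"  (infixl "\<oplus>\<index>" 65)
  sum_arr :: "'m \<Rightarrow> 'm \<Rightarrow> 'm"  (infixl "\<oplus>\<^sub>m\<index>" 65)
  zero_obj :: 'o  ("\<O>\<index>")
  sum_assoc :: "'o \<Rightarrow> 'o \<Rightarrow> 'o \<Rightarrow> 'm"  ("\<alpha>\<^sup>\<oplus>\<index>")
  sum_lunit :: "'o \<Rightarrow> 'm"  ("\<lambda>\<^sup>\<oplus>\<index>")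
  sum_runit :: "'o \<Rightarrow> 'm"  ("\<rho>\<^sup>\<oplus>\<index>")
  sum_sym :: "'o \<Rightarrow> 'o \<Rightarrow> 'm"  ("\<zeta>\<^sup>\<oplus>\<index>")
  prod_obj :: "'o \<Rightarrow> 'o \<Rightarrow> 'o"  (infixl "\<otimes>\<index>" 70)
  prod_arr :: "'m \<Rightarrow> 'm \<Rightarrow> 'm"  (infixl "\<otimes>\<^sub>m\<index>" 70)
  one_obj :: 'o  ("\<I>\<index>")
  prod_assoc :: "'o \<Rightarrow> 'o \<Rightarrow> 'o \<Rightarrow> 'm"  ("\<alpha>\<^sup>\<otimes>\<index>")
  prod_lunit :: "'o \<Rightarrow> 'm"  ("\<lambda>\<^sup>\<otimes>\<index>")
  prod_runit :: "'o \<Rightarrow> 'm"  ("\<rho>\<^sup>\<otimes>\<index>")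
  lnull :: "'o \<Rightarrow> 'm"  ("\<lambda>\<^sup>\<bullet>\<index>")
  rnull :: "'o \<Rightarrow> 'm"  ("\<rho>\<^sup>\<bullet>\<index>")
  ldistr :: "'o \<Rightarrow> 'o \<Rightarrow> 'o \<Rightarrow> 'm"  ("\<delta>\<^sup>l\<index>")
  rdistr :: "'o \<Rightarrow> 'o \<Rightarrow> 'o \<Rightarrow> 'm"  ("\<delta>\<^sup>r\<index>")

text \<open>
  The coherence isomorphism from \<open>(W \<oplus> X) \<oplus> (Y \<oplus> Z)\<close> to \<open>(W \<oplus> Y) \<oplus> (X \<oplus> Z)\<close>, through
  \<open>W \<oplus> (X \<oplus> (Y \<oplus> Z))\<close>, \<open>W \<oplus> ((X \<oplus> Y) \<oplus> Z)\<close>, \<open>W \<oplus> ((Y \<oplus> X) \<oplus> Z)\<close> and \<open>W \<oplus> (Y \<oplus> (X \<oplus> Z))\<close>.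
\<close>

definition middle_exchange ::
    "('o, 'm, 'x) bimonoidal_data_scheme \<Rightarrow> 'o \<Rightarrow> 'o \<Rightarrow> 'o \<Rightarrow> 'o \<Rightarrow> 'm"  ("\<mu>\<index>") where
  "\<mu>\<^bsub>C\<^esub> W X Y Z =
     inv\<^bsub>C\<^esub> (\<alpha>\<^sup>\<oplus>\<^bsub>C\<^esub> W Y (X \<oplus>\<^bsub>C\<^esub> Z)) \<cdot>\<^bsub>C\<^esub>
     (\<one>\<^bsub>C\<^esub> W \<oplus>\<^sub>m\<^bsub>C\<^esub> \<alpha>\<^sup>\<oplus>\<^bsub>C\<^esub> Y X Z) \<cdot>\<^bsub>C\<^esub>
     (\<one>\<^bsub>C\<^esub> W \<oplus>\<^sub>m\<^bsub>C\<^esub> (\<zeta>\<^sup>\<oplus>\<^bsub>C\<^esub> X Y \<oplus>\<^sub>m\<^bsub>C\<^esub> \<one>\<^bsub>C\<^esub> Z)) \<cdot>\<^bsub>C\<^esub>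
     (\<one>\<^bsub>C\<^esub> W \<oplus>\<^sub>m\<^bsub>C\<^esub> inv\<^bsub>C\<^esub> (\<alpha>\<^sup>\<oplus>\<^bsub>C\<^esub> X Y Z)) \<cdot>\<^bsub>C\<^esub>
     \<alpha>\<^sup>\<oplus>\<^bsub>C\<^esub> W X (Y \<oplus>\<^bsub>C\<^esub> Z)"

locale bimonoidal_category =
  add: symmetric_monoidal_category C "sum_obj C" "sum_arr C" "zero_obj C"
    "sum_assoc C" "sum_lunit C" "sum_runit C" "sum_sym C" +
  mult: monoidal_category C "prod_obj C" "prod_arr C" "one_obj C"
    "prod_assoc C" "prod_lunit C" "prod_runit C"
  for C :: "('o, 'm, 'x) bimonoidal_data_scheme" (structure) +
  assumes lnull_iso: "A \<in> Obj C \<Longrightarrow> \<lambda>\<^sup>\<bullet> A \<in> iso_arrs C (\<O> \<otimes> A) \<O>"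
    and lnull_natural: "f \<in> hom C A A' \<Longrightarrow> \<lambda>\<^sup>\<bullet> A' \<cdot> (\<one> \<O> \<otimes>\<^sub>m f) = \<lambda>\<^sup>\<bullet> A"
    and rnull_iso: "A \<in> Obj C \<Longrightarrow> \<rho>\<^sup>\<bullet> A \<in> iso_arrs C (A \<otimes> \<O>) \<O>"
    and rnull_natural: "f \<in> hom C A A' \<Longrightarrow> \<rho>\<^sup>\<bullet> A' \<cdot> (f \<otimes>\<^sub>m \<one> \<O>) = \<rho>\<^sup>\<bullet> A"
    and ldistr_mono: "A \<in> Obj C \<Longrightarrow> B \<in> Obj C \<Longrightarrow> D \<in> Obj C \<Longrightarrow>
      \<delta>\<^sup>l A B D \<in> mono_arrs C (A \<otimes> (B \<oplus> D)) (A \<otimes> B \<oplus> A \<otimes> D)"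
    and ldistr_natural: "f \<in> hom C A A' \<Longrightarrow> g \<in> hom C B B' \<Longrightarrow> h \<in> hom C D D' \<Longrightarrow>
      \<delta>\<^sup>l A' B' D' \<cdot> (f \<otimes>\<^sub>m (g \<oplus>\<^sub>m h)) = (f \<otimes>\<^sub>m g \<oplus>\<^sub>m f \<otimes>\<^sub>m h) \<cdot> \<delta>\<^sup>l A B D"
    and rdistr_mono: "A \<in> Obj C \<Longrightarrow> B \<in> Obj C \<Longrightarrow> D \<in> Obj C \<Longrightarrow>
      \<delta>\<^sup>r A B D \<in> mono_arrs C ((A \<oplus> B) \<otimes> D) (A \<otimes> D \<oplus> B \<otimes> D)"
    and rdistr_natural: "f \<in> hom C A A' \<Longrightarrow> g \<in> hom C B B' \<Longrightarrow> h \<in> hom C D D' \<Longrightarrow>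
      \<delta>\<^sup>r A' B' D' \<cdot> ((f \<oplus>\<^sub>m g) \<otimes>\<^sub>m h) = (f \<otimes>\<^sub>m h \<oplus>\<^sub>m g \<otimes>\<^sub>m h) \<cdot> \<delta>\<^sup>r A B D"
    and ldistr_sym: "A \<in> Obj C \<Longrightarrow> B \<in> Obj C \<Longrightarrow> D \<in> Obj C \<Longrightarrow>
      \<delta>\<^sup>l A D B \<cdot> (\<one> A \<otimes>\<^sub>m \<zeta>\<^sup>\<oplus> B D) = \<zeta>\<^sup>\<oplus> (A \<otimes> B) (A \<otimes> D) \<cdot> \<delta>\<^sup>l A B D"
    and rdistr_sym: "A \<in> Obj C \<Longrightarrow> B \<in> Obj C \<Longrightarrow> D \<in> Obj C \<Longrightarrow>
      \<delta>\<^sup>r B A D \<cdot> (\<zeta>\<^sup>\<oplus> A B \<otimes>\<^sub>m \<one> D) = \<zeta>\<^sup>\<oplus> (A \<otimes> D) (B \<otimes> D) \<cdot> \<delta>\<^sup>r A B D"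
    and rdistr_sum_assoc: "A \<in> Obj C \<Longrightarrow> B \<in> Obj C \<Longrightarrow> D \<in> Obj C \<Longrightarrow> E \<in> Obj C \<Longrightarrow>
      \<alpha>\<^sup>\<oplus> (A \<otimes> E) (B \<otimes> E) (D \<otimes> E) \<cdot> (\<delta>\<^sup>r A B E \<oplus>\<^sub>m \<one> (D \<otimes> E)) \<cdot> \<delta>\<^sup>r (A \<oplus> B) D E =
      (\<one> (A \<otimes> E) \<oplus>\<^sub>m \<delta>\<^sup>r B D E) \<cdot> \<delta>\<^sup>r A (B \<oplus> D) E \<cdot> (\<alpha>\<^sup>\<oplus> A B D \<otimes>\<^sub>m \<one> E)"
    and ldistr_sum_assoc: "A \<in> Obj C \<Longrightarrow> B \<in> Obj C \<Longrightarrow> D \<in> Obj C \<Longrightarrow> E \<in> Obj C \<Longrightarrow>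
      \<alpha>\<^sup>\<oplus> (A \<otimes> B) (A \<otimes> D) (A \<otimes> E) \<cdot> (\<delta>\<^sup>l A B D \<oplus>\<^sub>m \<one> (A \<otimes> E)) \<cdot> \<delta>\<^sup>l A (B \<oplus> D) E =
      (\<one> (A \<otimes> B) \<oplus>\<^sub>m \<delta>\<^sup>l A D E) \<cdot> \<delta>\<^sup>l A B (D \<oplus> E) \<cdot> (\<one> A \<otimes>\<^sub>m \<alpha>\<^sup>\<oplus> B D E)"
    and ldistr_prod_assoc: "A \<in> Obj C \<Longrightarrow> B \<in> Obj C \<Longrightarrow> D \<in> Obj C \<Longrightarrow> E \<in> Obj C \<Longrightarrow>
      \<delta>\<^sup>l A (B \<otimes> D) (B \<otimes> E) \<cdot> (\<one> A \<otimes>\<^sub>m \<delta>\<^sup>l B D E) \<cdot> \<alpha>\<^sup>\<otimes> A B (D \<oplus> E) =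
      (\<alpha>\<^sup>\<otimes> A B D \<oplus>\<^sub>m \<alpha>\<^sup>\<otimes> A B E) \<cdot> \<delta>\<^sup>l (A \<otimes> B) D E"
    and rdistr_prod_assoc: "A \<in> Obj C \<Longrightarrow> B \<in> Obj C \<Longrightarrow> D \<in> Obj C \<Longrightarrow> E \<in> Obj C \<Longrightarrow>
      (\<alpha>\<^sup>\<otimes> A D E \<oplus>\<^sub>m \<alpha>\<^sup>\<otimes> B D E) \<cdot> \<delta>\<^sup>r (A \<otimes> D) (B \<otimes> D) E \<cdot> (\<delta>\<^sup>r A B D \<otimes>\<^sub>m \<one> E) =
      \<delta>\<^sup>r A B (D \<otimes> E) \<cdot> \<alpha>\<^sup>\<otimes> (A \<oplus> B) D E"
    and lrdistr_prod_assoc: "A \<in> Obj C \<Longrightarrow> B \<in> Obj C \<Longrightarrow> D \<in> Obj C \<Longrightarrow> E \<in> Obj C \<Longrightarrow>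
      (\<alpha>\<^sup>\<otimes> A B E \<oplus>\<^sub>m \<alpha>\<^sup>\<otimes> A D E) \<cdot> \<delta>\<^sup>r (A \<otimes> B) (A \<otimes> D) E \<cdot> (\<delta>\<^sup>l A B D \<otimes>\<^sub>m \<one> E) =
      \<delta>\<^sup>l A (B \<otimes> E) (D \<otimes> E) \<cdot> (\<one> A \<otimes>\<^sub>m \<delta>\<^sup>r B D E) \<cdot> \<alpha>\<^sup>\<otimes> A (B \<oplus> D) E"
    and lrdistr_exchange: "A \<in> Obj C \<Longrightarrow> B \<in> Obj C \<Longrightarrow> D \<in> Obj C \<Longrightarrow> E \<in> Obj C \<Longrightarrow>
      \<mu> (A \<otimes> D) (A \<otimes> E) (B \<otimes> D) (B \<otimes> E) \<cdot> (\<delta>\<^sup>l A D E \<oplus>\<^sub>m \<delta>\<^sup>l B D E) \<cdot> \<delta>\<^sup>r A B (D \<oplus> E) =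
      (\<delta>\<^sup>r A B D \<oplus>\<^sub>m \<delta>\<^sup>r A B E) \<cdot> \<delta>\<^sup>l (A \<oplus> B) D E"
    and null_zero: "\<lambda>\<^sup>\<bullet> \<O> = \<rho>\<^sup>\<bullet> \<O>"
    and lnull_sum: "A \<in> Obj C \<Longrightarrow> B \<in> Obj C \<Longrightarrow>
      \<lambda>\<^sup>\<oplus> \<O> \<cdot> (\<lambda>\<^sup>\<bullet> A \<oplus>\<^sub>m \<lambda>\<^sup>\<bullet> B) \<cdot> \<delta>\<^sup>l \<O> A B = \<lambda>\<^sup>\<bullet> (A \<oplus> B)"
    and rnull_sum: "A \<in> Obj C \<Longrightarrow> B \<in> Obj C \<Longrightarrow>
      \<lambda>\<^sup>\<oplus> \<O> \<cdot> (\<rho>\<^sup>\<bullet> A \<oplus>\<^sub>m \<rho>\<^sup>\<bullet> B) \<cdot> \<delta>\<^sup>r A B \<O> = \<rho>\<^sup>\<bullet> (A \<oplus> B)"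
    and lnull_one: "\<rho>\<^sup>\<otimes> \<O> = \<lambda>\<^sup>\<bullet> \<I>"
    and rnull_one: "\<lambda>\<^sup>\<otimes> \<O> = \<rho>\<^sup>\<bullet> \<I>"
    and lnull_prod: "A \<in> Obj C \<Longrightarrow> B \<in> Obj C \<Longrightarrow>
      \<lambda>\<^sup>\<bullet> (A \<otimes> B) \<cdot> \<alpha>\<^sup>\<otimes> \<O> A B = \<lambda>\<^sup>\<bullet> B \<cdot> (\<lambda>\<^sup>\<bullet> A \<otimes>\<^sub>m \<one> B)"
    and lrnull_prod: "A \<in> Obj C \<Longrightarrow> B \<in> Obj C \<Longrightarrow>
      \<rho>\<^sup>\<bullet> A \<cdot> (\<one> A \<otimes>\<^sub>m \<lambda>\<^sup>\<bullet> B) \<cdot> \<alpha>\<^sup>\<otimes> A \<O> B = \<lambda>\<^sup>\<bullet> B \<cdot> (\<rho>\<^sup>\<bullet> A \<otimes>\<^sub>m \<one> B)"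
    and rnull_prod: "A \<in> Obj C \<Longrightarrow> B \<in> Obj C \<Longrightarrow>
      \<rho>\<^sup>\<bullet> A \<cdot> (\<one> A \<otimes>\<^sub>m \<rho>\<^sup>\<bullet> B) \<cdot> \<alpha>\<^sup>\<otimes> A B \<O> = \<rho>\<^sup>\<bullet> (A \<otimes> B)"
    and ldistr_zero_left: "A \<in> Obj C \<Longrightarrow> B \<in> Obj C \<Longrightarrow>
      \<lambda>\<^sup>\<oplus> (A \<otimes> B) \<cdot> (\<rho>\<^sup>\<bullet> A \<oplus>\<^sub>m \<one> (A \<otimes> B)) \<cdot> \<delta>\<^sup>l A \<O> B = \<one> A \<otimes>\<^sub>m \<lambda>\<^sup>\<oplus> B"
    and rdistr_zero_left: "A \<in> Obj C \<Longrightarrow> B \<in> Obj C \<Longrightarrow>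
      \<lambda>\<^sup>\<oplus> (B \<otimes> A) \<cdot> (\<lambda>\<^sup>\<bullet> A \<oplus>\<^sub>m \<one> (B \<otimes> A)) \<cdot> \<delta>\<^sup>r \<O> B A = \<lambda>\<^sup>\<oplus> B \<otimes>\<^sub>m \<one> A"
    and ldistr_zero_right: "A \<in> Obj C \<Longrightarrow> B \<in> Obj C \<Longrightarrow>
      \<rho>\<^sup>\<oplus> (A \<otimes> B) \<cdot> (\<one> (A \<otimes> B) \<oplus>\<^sub>m \<rho>\<^sup>\<bullet> A) \<cdot> \<delta>\<^sup>l A B \<O> = \<one> A \<otimes>\<^sub>m \<rho>\<^sup>\<oplus> B"
    and rdistr_zero_right: "A \<in> Obj C \<Longrightarrow> B \<in> Obj C \<Longrightarrow>
      \<rho>\<^sup>\<oplus> (A \<otimes> B) \<cdot> (\<one> (A \<otimes> B) \<oplus>\<^sub>m \<lambda>\<^sup>\<bullet> B) \<cdot> \<delta>\<^sup>r A \<O> B = \<rho>\<^sup>\<oplus> A \<otimes>\<^sub>m \<one> B"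
    and ldistr_one: "A \<in> Obj C \<Longrightarrow> B \<in> Obj C \<Longrightarrow>
      (\<lambda>\<^sup>\<otimes> A \<oplus>\<^sub>m \<lambda>\<^sup>\<otimes> B) \<cdot> \<delta>\<^sup>l \<I> A B = \<lambda>\<^sup>\<otimes> (A \<oplus> B)"
    and rdistr_one: "A \<in> Obj C \<Longrightarrow> B \<in> Obj C \<Longrightarrow>
      (\<rho>\<^sup>\<otimes> A \<oplus>\<^sub>m \<rho>\<^sup>\<otimes> B) \<cdot> \<delta>\<^sup>r A B \<I> = \<rho>\<^sup>\<otimes> (A \<oplus> B)"


section \<open>Braided and symmetric bimonoidal categories\<close>

record ('o, 'm) braided_bimonoidal_data = "('o, 'm) bimonoidal_data" +
  prod_braid :: "'o \<Rightarrow> 'o \<Rightarrow> 'm"  ("\<zeta>\<^sup>\<otimes>\<index>")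

locale braided_bimonoidal_category =
  bimonoidal_category C +
  mult: braided_monoidal_category C "prod_obj C" "prod_arr C" "one_obj C"
    "prod_assoc C" "prod_lunit C" "prod_runit C" "prod_braid C"
  for C :: "('o, 'm, 'x) braided_bimonoidal_data_scheme" (structure) +
  assumes ldistr_braid: "A \<in> Obj C \<Longrightarrow> B \<in> Obj C \<Longrightarrow> D \<in> Obj C \<Longrightarrow>
      \<delta>\<^sup>l D A B \<cdot> \<zeta>\<^sup>\<otimes> (A \<oplus> B) D = (\<zeta>\<^sup>\<otimes> A D \<oplus>\<^sub>m \<zeta>\<^sup>\<otimes> B D) \<cdot> \<delta>\<^sup>r A B D"
    and rdistr_braid: "A \<in> Obj C \<Longrightarrow> B \<in> Obj C \<Longrightarrow> D \<in> Obj C \<Longrightarrow>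
      \<delta>\<^sup>r B D A \<cdot> \<zeta>\<^sup>\<otimes> A (B \<oplus> D) = (\<zeta>\<^sup>\<otimes> A B \<oplus>\<^sub>m \<zeta>\<^sup>\<otimes> A D) \<cdot> \<delta>\<^sup>l A B D"
    and lnull_braid: "A \<in> Obj C \<Longrightarrow> \<lambda>\<^sup>\<bullet> A \<cdot> \<zeta>\<^sup>\<otimes> A \<O> = \<rho>\<^sup>\<bullet> A"
    and rnull_braid: "A \<in> Obj C \<Longrightarrow> \<rho>\<^sup>\<bullet> A \<cdot> \<zeta>\<^sup>\<otimes> \<O> A = \<lambda>\<^sup>\<bullet> A"

locale symmetric_bimonoidal_category = braided_bimonoidal_category +
  assumes prod_symmetry: "A \<in> Obj C \<Longrightarrow> B \<in> Obj C \<Longrightarrow> \<zeta>\<^sup>\<otimes> B A \<cdot> \<zeta>\<^sup>\<otimes> A B = \<one> (A \<otimes> B)"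

definition bimonoidal_symmetric_center ::
    "('o, 'm, 'x) braided_bimonoidal_data_scheme \<Rightarrow> ('o, 'm, 'x) braided_bimonoidal_data_scheme" where
  "bimonoidal_symmetric_center C = full_subcategory C
     {A \<in> Obj C. \<forall>B \<in> Obj C. \<zeta>\<^sup>\<otimes>\<^bsub>C\<^esub> B A \<cdot>\<^bsub>C\<^esub> \<zeta>\<^sup>\<otimes>\<^bsub>C\<^esub> A B = \<one>\<^bsub>C\<^esub> (A \<otimes>\<^bsub>C\<^esub> B)}"

end

theory Submission
  imports Defs
begin

text \<open>
  Call \<open>\<zeta> B A \<cdot> \<zeta> A B\<close> the double braiding of \<open>A\<close> with \<open>B\<close>. The center consists of the objects
  whose double braidings are all identities, so symmetry holds in it by definition. Every axiom of a
  braided bimonoidal category is an equation between composites, or the invertibility or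
  monomorphy of a structure arrow, and each of these passes to a full subcategory whose set of objects
  is closed under \<open>\<oplus>\<close>, \<open>\<otimes>\<close>, the zero and the unit: inverses in the large category have their domain and
  codomain in the subcategory, and a monomorphism has fewer pairs of arrows to separate there. This is
  \<open>full_subcategory_braided_bimonoidal\<close>. What remains is the closure of the center, one argument for
  each operation.

  Tensor product (\<open>double_braid_tensor\<close>): by the hexagons the double braiding of \<open>A \<otimes> B\<close> with \<open>D\<close> is a
  composite of associators and braidings in which that of \<open>A\<close> with \<open>D\<close> cancels, and
  then that of \<open>B\<close> with \<open>D\<close>.

  Unit (\<open>double_braid_unit\<close>): the hexagons force \<open>r D \<cdot> \<zeta> I D = l D\<close> and \<open>l D \<cdot> \<zeta> D I = r D\<close>, so the
  double braiding becomes an identity after composition with the isomorphism \<open>l D\<close>. Both identities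
  rest on Kelly's theorem that \<open>(\<one> A \<otimes>\<^sub>m r B) \<cdot> \<alpha> A B I = r (A \<otimes> B)\<close> (\<open>runit_tensor\<close>).

  Zero (\<open>double_braid_zero\<close>): the same argument with the null isomorphisms \<open>\<lambda>\<^sup>\<bullet>\<close> and \<open>\<rho>\<^sup>\<bullet>\<close>, whose
  compatibility with the braiding is an axiom.

  Sum (\<open>double_braid_sum\<close>): the distributor \<open>\<delta>\<^sup>r A B D\<close> carries the double braiding of \<open>A \<oplus> B\<close> with \<open>D\<close>
  to the sum of the double braidings of \<open>A\<close> and of \<open>B\<close>. If these are identities the double
  braiding of \<open>A \<oplus> B\<close> is one too, because \<open>\<delta>\<^sup>r\<close> is a monomorphism.
\<close>

section \<open>Arrow calculus\<close>

lemma in_homD: "f \<in> hom C A B \<Longrightarrow> f \<in> Arr C" "f \<in> hom C A B \<Longrightarrow> Dom C f = A"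
  "f \<in> hom C A B \<Longrightarrow> Cod C f = B"
  by (auto simp: hom_def)

lemma homI: "f \<in> Arr C \<Longrightarrow> Dom C f = A \<Longrightarrow> Cod C f = B \<Longrightarrow> f \<in> hom C A B"
  by (simp add: hom_def)

lemma iso_arrs_hom: "f \<in> iso_arrs C A B \<Longrightarrow> f \<in> hom C A B"
  by (simp add: iso_arrs_def)

lemma mono_arrs_hom: "f \<in> mono_arrs C A B \<Longrightarrow> f \<in> hom C A B"
  by (simp add: mono_arrs_def)

context category
begin

lemma hom_Obj: "f \<in> hom C A B \<Longrightarrow> A \<in> Obj C" "f \<in> hom C A B \<Longrightarrow> B \<in> Obj C"
  using dom_closed cod_closed by (auto simp: hom_def)

lemma id_typing: "A \<in> Obj C \<Longrightarrow> \<one> A \<in> Arr C" "A \<in> Obj C \<Longrightarrow> Dom C (\<one> A) = A"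
  "A \<in> Obj C \<Longrightarrow> Cod C (\<one> A) = A"
  using id_closed by (auto simp: hom_def)

lemma comp_typing:
  assumes "f \<in> Arr C" "g \<in> Arr C" "Cod C f = Dom C g"
  shows "g \<cdot> f \<in> Arr C" "Dom C (g \<cdot> f) = Dom C f" "Cod C (g \<cdot> f) = Cod C g"
proof -
  have "g \<cdot> f \<in> hom C (Dom C f) (Cod C g)"
    by (rule comp_closed[of f _ "Dom C g"]) (simp_all add: homI assms)
  then show "g \<cdot> f \<in> Arr C" "Dom C (g \<cdot> f) = Dom C f" "Cod C (g \<cdot> f) = Cod C g"
    by (rule in_homD)+
qed

lemma comp_assoc':
  assumes "f \<in> Arr C" "g \<in> Arr C" "h \<in> Arr C" "Cod C f = Dom C g" "Cod C g = Dom C h"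
  shows "(h \<cdot> g) \<cdot> f = h \<cdot> (g \<cdot> f)"
  by (rule comp_assoc[of f "Dom C f" "Dom C g" g "Dom C h" h "Cod C h"]) (simp_all add: homI assms)

lemma id_left': "f \<in> Arr C \<Longrightarrow> Cod C f = B \<Longrightarrow> \<one> B \<cdot> f = f"
  by (rule id_left[of f "Dom C f"]) (simp add: homI)

lemma id_right': "f \<in> Arr C \<Longrightarrow> Dom C f = A \<Longrightarrow> f \<cdot> \<one> A = f"
  by (rule id_right[of f A "Cod C f"]) (simp add: homI)

text \<open>
  The category axioms are restated with separate equations for domains and codomains: in this form
  the simplifier checks composability while it normalises composites to the right.
\<close>

lemmas arrow_simps = dom_closed cod_closed id_typing comp_typing comp_assoc' id_left' id_right'

lemma is_inverse_unique:
  assumes f: "f \<in> Arr C" and g: "is_inverse C f g" and h: "is_inverse C f h"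
  shows "g = h"
proof -
  have t: "f \<in> hom C (Dom C f) (Cod C f)" "g \<in> hom C (Cod C f) (Dom C f)"
    "h \<in> hom C (Cod C f) (Dom C f)"
    using assms by (simp_all add: is_inverse_def homI)
  have "g = (h \<cdot> f) \<cdot> g"
    using h id_left[OF t(2)] by (simp add: is_inverse_def)
  also have "\<dots> = h \<cdot> (f \<cdot> g)"
    using t(2,1,3) by (rule comp_assoc)
  also have "\<dots> = h"
    using g id_right[OF t(3)] by (simp add: is_inverse_def)
  finally show ?thesis .
qed

lemma is_inverse_inverse_arr:
  assumes "f \<in> iso_arrs C A B"
  shows "is_inverse C f (inv f)"
proof -
  obtain g where g: "is_inverse C f g" and f: "f \<in> Arr C"
    using assms by (auto simp: iso_arrs_def hom_def)
  show ?thesis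
    unfolding inverse_arr_def
  proof (rule theI)
    show "is_inverse C f g" by (rule g)
    show "h = g" if "is_inverse C f h" for h
      using f that g by (rule is_inverse_unique)
  qed
qed

lemma inverse_arr_facts:
  assumes "f \<in> iso_arrs C A B"
  shows "inv f \<in> hom C B A" "inv f \<cdot> f = \<one> A" "f \<cdot> inv f = \<one> B"
proof -
  have "Dom C f = A" "Cod C f = B"
    using iso_arrs_hom[OF assms] by (simp_all add: in_homD)
  then show "inv f \<in> hom C B A" "inv f \<cdot> f = \<one> A" "f \<cdot> inv f = \<one> B"
    using is_inverse_inverse_arr[OF assms] by (simp_all add: is_inverse_def)
qed

lemma iso_cancel_left:
  assumes i: "i \<in> iso_arrs C B D" and f: "f \<in> hom C A B" and g: "g \<in> hom C A B"
    and eq: "i \<cdot> f = i \<cdot> g"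
  shows "f = g"
proof -
  have i': "i \<in> hom C B D" using i by (rule iso_arrs_hom)
  have "(inv i \<cdot> i) \<cdot> f = (inv i \<cdot> i) \<cdot> g"
    using comp_assoc[OF f i' inverse_arr_facts(1)[OF i]]
      comp_assoc[OF g i' inverse_arr_facts(1)[OF i]] eq by simp
  then show ?thesis
    using f g by (simp add: inverse_arr_facts[OF i] id_left)
qed

lemma iso_cancel_right:
  assumes i: "i \<in> iso_arrs C A B" and f: "f \<in> hom C B D" and g: "g \<in> hom C B D"
    and eq: "f \<cdot> i = g \<cdot> i"
  shows "f = g"
proof -
  have i': "i \<in> hom C A B" using i by (rule iso_arrs_hom)
  have "f \<cdot> (i \<cdot> inv i) = g \<cdot> (i \<cdot> inv i)"
    using comp_assoc[OF inverse_arr_facts(1)[OF i] i' f]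
      comp_assoc[OF inverse_arr_facts(1)[OF i] i' g] eq by simp
  then show ?thesis
    using f g by (simp add: inverse_arr_facts[OF i] id_right)
qed

lemma mono_cancel:
  assumes "m \<in> mono_arrs C B D" and "f \<in> hom C A B" "g \<in> hom C A B" and "m \<cdot> f = m \<cdot> g"
  shows "f = g"
  using assms hom_Obj(1)[of f A B] by (auto simp: mono_arrs_def)

end

section \<open>Restriction of monoidal structures to full subcategories\<close>

lemma full_subcategory_simps:
  "Obj (full_subcategory C S) = S"
  "Dom (full_subcategory C S) = Dom C"
  "Cod (full_subcategory C S) = Cod C"
  "Id (full_subcategory C S) = Id C"
  "Comp (full_subcategory C S) = Comp C"
  by (simp_all add: full_subcategory_def)

lemma full_subcategory_hom:
  "f \<in> hom (full_subcategory C S) A B \<longleftrightarrow> f \<in> hom C A B \<and> A \<in> S \<and> B \<in> S"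
  by (auto simp: hom_def full_subcategory_def)

lemma full_subcategory_is_inverse:
  "Dom C f \<in> S \<Longrightarrow> Cod C f \<in> S \<Longrightarrow> is_inverse (full_subcategory C S) f g \<longleftrightarrow> is_inverse C f g"
  by (simp add: is_inverse_def full_subcategory_hom full_subcategory_simps)

text \<open>
  Inverses are descriptions over the arrows of a category, so that it has to be shown that the
  subcategory and the large category describe the same arrow.
\<close>

lemma full_subcategory_inverse_arr:
  "f \<in> hom C A B \<Longrightarrow> A \<in> S \<Longrightarrow> B \<in> S \<Longrightarrow> inv\<^bsub>full_subcategory C S\<^esub> f = inv\<^bsub>C\<^esub> f"
  by (simp add: inverse_arr_def full_subcategory_is_inverse in_homD)

lemma full_subcategory_iso_arrs:
  "f \<in> iso_arrs (full_subcategory C S) A B \<longleftrightarrow> f \<in> iso_arrs C A B \<and> A \<in> S \<and> B \<in> S"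
  by (auto simp: iso_arrs_def full_subcategory_hom full_subcategory_is_inverse in_homD)

lemma full_subcategory_mono_arrs:
  "f \<in> mono_arrs C A B \<Longrightarrow> A \<in> S \<Longrightarrow> B \<in> S \<Longrightarrow> S \<subseteq> Obj C \<Longrightarrow>
    f \<in> mono_arrs (full_subcategory C S) A B"
  by (auto simp: mono_arrs_def full_subcategory_hom full_subcategory_simps)

lemma (in category) full_subcategory_category:
  assumes S: "S \<subseteq> Obj C"
  shows "category (full_subcategory C S)"
proof (rule category.intro, unfold full_subcategory_simps full_subcategory_hom)
  show "Dom C f \<in> S" "Cod C f \<in> S" if "f \<in> Arr (full_subcategory C S)" for f
    using that by (simp_all add: full_subcategory_def)
qed ((elim conjE)?; (intro conjI)?;
    (assumption |
      (rule id_closed comp_closed id_left id_right comp_assoc;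
        (assumption | simp add: subsetD[OF S]; fail))))+

text \<open>
  In the statements about a single tensor product, \<open>\<otimes>\<close> and \<open>\<otimes>\<^sub>m\<close> are the locale parameters and never
  the multiplicative product of a bimonoidal category.
\<close>

no_notation prod_obj (infixl "\<otimes>\<index>" 70)
no_notation prod_arr (infixl "\<otimes>\<^sub>m\<index>" 70)

lemma (in monoidal_category) full_subcategory_monoidal:
  assumes S: "S \<subseteq> Obj C" and I: "I \<in> S" and T: "\<And>A B. A \<in> S \<Longrightarrow> B \<in> S \<Longrightarrow> A \<otimes> B \<in> S"
  shows "monoidal_category (full_subcategory C S) tobj tarr I \<alpha> l r"
proof (intro monoidal_category.intro full_subcategory_category S monoidal_category_axioms.intro,
    unfold full_subcategory_simps full_subcategory_hom full_subcategory_iso_arrs)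
qed ((elim conjE)?; (intro conjI)?;
    (assumption | (simp add: I T; fail) |
      (rule tarr_closed tarr_id tarr_comp assoc_iso assoc_natural lunit_iso lunit_natural
          runit_iso runit_natural pentagon triangle;
        (assumption | simp add: I T S subsetD[OF S]; fail))))+

lemma (in braided_monoidal_category) full_subcategory_braided:
  assumes S: "S \<subseteq> Obj C" and I: "I \<in> S" and T: "\<And>A B. A \<in> S \<Longrightarrow> B \<in> S \<Longrightarrow> A \<otimes> B \<in> S"
  shows "braided_monoidal_category (full_subcategory C S) tobj tarr I \<alpha> l r \<zeta>"
proof (intro braided_monoidal_category.intro full_subcategory_monoidal S I T
    braided_monoidal_category_axioms.intro,
    unfold full_subcategory_simps full_subcategory_hom full_subcategory_iso_arrs)
  have inv_eq: "inv\<^bsub>full_subcategory C S\<^esub> (\<alpha> A B D) = inv (\<alpha> A B D)"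
    if "A \<in> S" "B \<in> S" "D \<in> S" for A B D
    using that T assoc_iso[of A B D]
    by (auto intro!: full_subcategory_inverse_arr iso_arrs_hom simp: subsetD[OF S])
  show "inv\<^bsub>full_subcategory C S\<^esub> (\<alpha> D A B) \<cdot> \<zeta> (A \<otimes> B) D \<cdot> inv\<^bsub>full_subcategory C S\<^esub> (\<alpha> A B D) =
      (\<zeta> A D \<otimes>\<^sub>m \<one> B) \<cdot> inv\<^bsub>full_subcategory C S\<^esub> (\<alpha> A D B) \<cdot> (\<one> A \<otimes>\<^sub>m \<zeta> B D)"
    if "A \<in> S" "B \<in> S" "D \<in> S" for A B D
    using that by (simp add: inv_eq hexagon_left subsetD[OF S])
qed ((elim conjE)?; (intro conjI)?;
    (assumption | (simp add: T; fail) |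
      (rule braid_iso braid_natural hexagon_right;
        (assumption | simp add: T subsetD[OF S]; fail))))+

lemma (in symmetric_monoidal_category) full_subcategory_symmetric:
  assumes S: "S \<subseteq> Obj C" and I: "I \<in> S" and T: "\<And>A B. A \<in> S \<Longrightarrow> B \<in> S \<Longrightarrow> A \<otimes> B \<in> S"
  shows "symmetric_monoidal_category (full_subcategory C S) tobj tarr I \<alpha> l r \<zeta>"
proof (intro symmetric_monoidal_category.intro full_subcategory_braided S I T
    symmetric_monoidal_category_axioms.intro, unfold full_subcategory_simps)
qed (assumption | (rule symmetry; simp add: subsetD[OF S]))+

section \<open>Double braidings with the unit and with tensor products\<close>

context monoidal_category
begin

lemma tarr_typing:
  assumes "f \<in> Arr C" "g \<in> Arr C"
  shows "f \<otimes>\<^sub>m g \<in> Arr C" "Dom C (f \<otimes>\<^sub>m g) = Dom C f \<otimes> Dom C g"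
    "Cod C (f \<otimes>\<^sub>m g) = Cod C f \<otimes> Cod C g"
proof -
  have "f \<otimes>\<^sub>m g \<in> hom C (Dom C f \<otimes> Dom C g) (Cod C f \<otimes> Cod C g)"
    by (rule tarr_closed) (simp_all add: homI assms)
  then show "f \<otimes>\<^sub>m g \<in> Arr C" "Dom C (f \<otimes>\<^sub>m g) = Dom C f \<otimes> Dom C g"
    "Cod C (f \<otimes>\<^sub>m g) = Cod C f \<otimes> Cod C g"
    by (rule in_homD)+
qed

lemma structure_typing:
  shows "A \<in> Obj C \<Longrightarrow> B \<in> Obj C \<Longrightarrow> D \<in> Obj C \<Longrightarrow> \<alpha> A B D \<in> hom C ((A \<otimes> B) \<otimes> D) (A \<otimes> (B \<otimes> D))"
    and "A \<in> Obj C \<Longrightarrow> l A \<in> hom C (I \<otimes> A) A"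
    and "A \<in> Obj C \<Longrightarrow> r A \<in> hom C (A \<otimes> I) A"
  by (blast intro: iso_arrs_hom assoc_iso lunit_iso runit_iso)+

lemmas typing_simps = arrow_simps tobj_closed unit_closed tarr_typing
  structure_typing[THEN in_homD(1)] structure_typing[THEN in_homD(2)] structure_typing[THEN in_homD(3)]

lemma whisker_right_comp:
  assumes "f \<in> Arr C" "g \<in> Arr C" "Cod C f = Dom C g" "B \<in> Obj C"
  shows "(g \<cdot> f) \<otimes>\<^sub>m \<one> B = (g \<otimes>\<^sub>m \<one> B) \<cdot> (f \<otimes>\<^sub>m \<one> B)"
proof -
  have "(g \<cdot> f) \<otimes>\<^sub>m (\<one> B \<cdot> \<one> B) = (g \<otimes>\<^sub>m \<one> B) \<cdot> (f \<otimes>\<^sub>m \<one> B)"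
    by (rule tarr_comp[of f "Dom C f" "Dom C g" g "Cod C g" "\<one> B" B B "\<one> B" B])
      (simp_all add: homI typing_simps assms)
  then show ?thesis by (simp add: typing_simps assms)
qed

lemma whisker_left_comp:
  assumes "f \<in> Arr C" "g \<in> Arr C" "Cod C f = Dom C g" "B \<in> Obj C"
  shows "\<one> B \<otimes>\<^sub>m (g \<cdot> f) = (\<one> B \<otimes>\<^sub>m g) \<cdot> (\<one> B \<otimes>\<^sub>m f)"
proof -
  have "(\<one> B \<cdot> \<one> B) \<otimes>\<^sub>m (g \<cdot> f) = (\<one> B \<otimes>\<^sub>m g) \<cdot> (\<one> B \<otimes>\<^sub>m f)"
    by (rule tarr_comp[of "\<one> B" B B "\<one> B" B f "Dom C f" "Dom C g" g "Cod C g"])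
      (simp_all add: homI typing_simps assms)
  then show ?thesis by (simp add: typing_simps assms)
qed

lemma whisker_right_iso:
  assumes f: "f \<in> iso_arrs C A A'" and B: "B \<in> Obj C"
  shows "f \<otimes>\<^sub>m \<one> B \<in> iso_arrs C (A \<otimes> B) (A' \<otimes> B)"
proof -
  note inv = inverse_arr_facts[OF f]
  note t = iso_arrs_hom[OF f, THEN in_homD(1)] iso_arrs_hom[OF f, THEN in_homD(2)]
    iso_arrs_hom[OF f, THEN in_homD(3)] inv(1)[THEN in_homD(1)] inv(1)[THEN in_homD(2)]
    inv(1)[THEN in_homD(3)] hom_Obj[OF inv(1)] B typing_simps
  have "is_inverse C (f \<otimes>\<^sub>m \<one> B) (inv f \<otimes>\<^sub>m \<one> B)"
    by (simp add: is_inverse_def hom_def whisker_right_comp[symmetric] inv(2,3) tarr_id t)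
  moreover have "f \<otimes>\<^sub>m \<one> B \<in> hom C (A \<otimes> B) (A' \<otimes> B)"
    by (simp add: homI t)
  ultimately show ?thesis
    unfolding iso_arrs_def by blast
qed

text \<open>
  Tensoring with the unit is naturally isomorphic to the identity functor, hence faithful. This lets
  equations be proved after tensoring with \<open>I\<close>, where the coherence axioms apply.
\<close>

lemma left_unit_faithful:
  assumes f: "f \<in> hom C A B" and g: "g \<in> hom C A B" and eq: "\<one> I \<otimes>\<^sub>m f = \<one> I \<otimes>\<^sub>m g"
  shows "f = g"
proof -
  have "f \<cdot> l A = g \<cdot> l A"
    using lunit_natural[OF f] lunit_natural[OF g] eq by simp
  with lunit_iso[OF hom_Obj(1)[OF f]] f g show ?thesis
    by (rule iso_cancel_right)
qed

lemma right_unit_faithful: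
  assumes f: "f \<in> hom C A B" and g: "g \<in> hom C A B" and eq: "f \<otimes>\<^sub>m \<one> I = g \<otimes>\<^sub>m \<one> I"
  shows "f = g"
proof -
  have "f \<cdot> r A = g \<cdot> r A"
    using runit_natural[OF f] runit_natural[OF g] eq by simp
  with runit_iso[OF hom_Obj(1)[OF f]] f g show ?thesis
    by (rule iso_cancel_right)
qed

text \<open>
  Kelly's argument: both sides are compared after tensoring with \<open>I\<close> on the right and composing with
  an associator. There the pentagon for \<open>A\<close>, \<open>B\<close>, \<open>I\<close>, \<open>I\<close> followed by \<open>\<one> A \<otimes>\<^sub>m (\<one> B \<otimes>\<^sub>m l I)\<close> turns
  one into the other, by two uses of the triangle and naturality of the associator.
\<close>

lemma runit_tensor:
  assumes A: "A \<in> Obj C" and B: "B \<in> Obj C"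
  shows "(\<one> A \<otimes>\<^sub>m r B) \<cdot> \<alpha> A B I = r (A \<otimes> B)"
proof (rule right_unit_faithful)
  note t = A B typing_simps
  let ?k = "(\<one> A \<otimes>\<^sub>m r B) \<cdot> \<alpha> A B I"
  show "?k \<in> hom C ((A \<otimes> B) \<otimes> I) (A \<otimes> B)" "r (A \<otimes> B) \<in> hom C ((A \<otimes> B) \<otimes> I) (A \<otimes> B)"
    by (auto intro!: homI simp: t)
  show "?k \<otimes>\<^sub>m \<one> I = r (A \<otimes> B) \<otimes>\<^sub>m \<one> I"
  proof (rule iso_cancel_left)
    show "\<alpha> A B I \<in> iso_arrs C ((A \<otimes> B) \<otimes> I) (A \<otimes> (B \<otimes> I))"
      by (simp add: assoc_iso t)
    show "?k \<otimes>\<^sub>m \<one> I \<in> hom C (((A \<otimes> B) \<otimes> I) \<otimes> I) ((A \<otimes> B) \<otimes> I)"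
      "r (A \<otimes> B) \<otimes>\<^sub>m \<one> I \<in> hom C (((A \<otimes> B) \<otimes> I) \<otimes> I) ((A \<otimes> B) \<otimes> I)"
      by (auto intro!: homI simp: t)
    have "\<alpha> A B I \<cdot> (?k \<otimes>\<^sub>m \<one> I) = (\<alpha> A B I \<cdot> ((\<one> A \<otimes>\<^sub>m r B) \<otimes>\<^sub>m \<one> I)) \<cdot> (\<alpha> A B I \<otimes>\<^sub>m \<one> I)"
      by (simp add: whisker_right_comp t)
    also have "\<alpha> A B I \<cdot> ((\<one> A \<otimes>\<^sub>m r B) \<otimes>\<^sub>m \<one> I) = (\<one> A \<otimes>\<^sub>m (r B \<otimes>\<^sub>m \<one> I)) \<cdot> \<alpha> A (B \<otimes> I) I"
      by (rule assoc_natural) (auto intro!: homI simp: t)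
    also have "\<one> A \<otimes>\<^sub>m (r B \<otimes>\<^sub>m \<one> I) = (\<one> A \<otimes>\<^sub>m (\<one> B \<otimes>\<^sub>m l I)) \<cdot> (\<one> A \<otimes>\<^sub>m \<alpha> B I I)"
      by (simp add: triangle[symmetric] whisker_left_comp t)
    also have "(\<dots> \<cdot> \<alpha> A (B \<otimes> I) I) \<cdot> (\<alpha> A B I \<otimes>\<^sub>m \<one> I) =
        (\<one> A \<otimes>\<^sub>m (\<one> B \<otimes>\<^sub>m l I)) \<cdot> ((\<one> A \<otimes>\<^sub>m \<alpha> B I I) \<cdot> \<alpha> A (B \<otimes> I) I \<cdot> (\<alpha> A B I \<otimes>\<^sub>m \<one> I))"
      by (simp add: t)
    also have "\<dots> = (\<one> A \<otimes>\<^sub>m (\<one> B \<otimes>\<^sub>m l I)) \<cdot> (\<alpha> A B (I \<otimes> I) \<cdot> \<alpha> (A \<otimes> B) I I)"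
      by (subst pentagon) (simp_all add: t)
    also have "\<dots> = ((\<one> A \<otimes>\<^sub>m (\<one> B \<otimes>\<^sub>m l I)) \<cdot> \<alpha> A B (I \<otimes> I)) \<cdot> \<alpha> (A \<otimes> B) I I"
      by (simp add: t)
    also have "(\<one> A \<otimes>\<^sub>m (\<one> B \<otimes>\<^sub>m l I)) \<cdot> \<alpha> A B (I \<otimes> I) = \<alpha> A B I \<cdot> ((\<one> A \<otimes>\<^sub>m \<one> B) \<otimes>\<^sub>m l I)"
      by (rule assoc_natural[symmetric]) (auto intro!: homI simp: t)
    also have "\<dots> \<cdot> \<alpha> (A \<otimes> B) I I = \<alpha> A B I \<cdot> ((\<one> (A \<otimes> B) \<otimes>\<^sub>m l I) \<cdot> \<alpha> (A \<otimes> B) I I)"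
      by (simp add: tarr_id t)
    also have "(\<one> (A \<otimes> B) \<otimes>\<^sub>m l I) \<cdot> \<alpha> (A \<otimes> B) I I = r (A \<otimes> B) \<otimes>\<^sub>m \<one> I"
      by (rule triangle) (simp_all add: t)
    finally show "\<alpha> A B I \<cdot> (?k \<otimes>\<^sub>m \<one> I) = \<alpha> A B I \<cdot> (r (A \<otimes> B) \<otimes>\<^sub>m \<one> I)" .
  qed
qed

end

context braided_monoidal_category
begin

lemma braid_typing: "A \<in> Obj C \<Longrightarrow> B \<in> Obj C \<Longrightarrow> \<zeta> A B \<in> hom C (A \<otimes> B) (B \<otimes> A)"
  by (rule iso_arrs_hom) (rule braid_iso)

lemma inverse_assoc_typing:
  "A \<in> Obj C \<Longrightarrow> B \<in> Obj C \<Longrightarrow> D \<in> Obj C \<Longrightarrow> inv (\<alpha> A B D) \<in> hom C (A \<otimes> (B \<otimes> D)) ((A \<otimes> B) \<otimes> D)"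
  by (rule inverse_arr_facts(1)) (rule assoc_iso)

lemmas braid_simps = typing_simps
  braid_typing[THEN in_homD(1)] braid_typing[THEN in_homD(2)] braid_typing[THEN in_homD(3)]
  inverse_assoc_typing[THEN in_homD(1)] inverse_assoc_typing[THEN in_homD(2)]
  inverse_assoc_typing[THEN in_homD(3)]

lemma assoc_inverse_cancel:
  assumes "A \<in> Obj C" "B \<in> Obj C" "D \<in> Obj C"
  shows "\<alpha> A B D \<cdot> inv (\<alpha> A B D) = \<one> (A \<otimes> (B \<otimes> D))"
    and "inv (\<alpha> A B D) \<cdot> \<alpha> A B D = \<one> ((A \<otimes> B) \<otimes> D)"
    and "f \<in> Arr C \<Longrightarrow> Cod C f = A \<otimes> (B \<otimes> D) \<Longrightarrow> \<alpha> A B D \<cdot> inv (\<alpha> A B D) \<cdot> f = f"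
    and "f \<in> Arr C \<Longrightarrow> Cod C f = (A \<otimes> B) \<otimes> D \<Longrightarrow> inv (\<alpha> A B D) \<cdot> \<alpha> A B D \<cdot> f = f"
proof -
  show 1: "\<alpha> A B D \<cdot> inv (\<alpha> A B D) = \<one> (A \<otimes> (B \<otimes> D))"
    and 2: "inv (\<alpha> A B D) \<cdot> \<alpha> A B D = \<one> ((A \<otimes> B) \<otimes> D)"
    using inverse_arr_facts(2,3)[OF assoc_iso[OF assms]] by simp_all
  note t = assms braid_simps
  show "\<alpha> A B D \<cdot> inv (\<alpha> A B D) \<cdot> f = f" if "f \<in> Arr C" "Cod C f = A \<otimes> (B \<otimes> D)"
    using comp_assoc'[of f "inv (\<alpha> A B D)" "\<alpha> A B D"] that by (simp add: 1 t)
  show "inv (\<alpha> A B D) \<cdot> \<alpha> A B D \<cdot> f = f" if "f \<in> Arr C" "Cod C f = (A \<otimes> B) \<otimes> D"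
    using comp_assoc'[of f "\<alpha> A B D" "inv (\<alpha> A B D)"] that by (simp add: 2 t)
qed

lemma braid_tensor_left:
  assumes "A \<in> Obj C" "B \<in> Obj C" "D \<in> Obj C"
  shows "\<zeta> (A \<otimes> B) D =
    \<alpha> D A B \<cdot> (\<zeta> A D \<otimes>\<^sub>m \<one> B) \<cdot> inv (\<alpha> A D B) \<cdot> (\<one> A \<otimes>\<^sub>m \<zeta> B D) \<cdot> \<alpha> A B D"
proof -
  note t = assms braid_simps
  have "\<zeta> (A \<otimes> B) D = \<alpha> D A B \<cdot> (inv (\<alpha> D A B) \<cdot> \<zeta> (A \<otimes> B) D \<cdot> inv (\<alpha> A B D)) \<cdot> \<alpha> A B D"
    by (simp add: t assoc_inverse_cancel)
  also have "\<dots> = \<alpha> D A B \<cdot> ((\<zeta> A D \<otimes>\<^sub>m \<one> B) \<cdot> inv (\<alpha> A D B) \<cdot> (\<one> A \<otimes>\<^sub>m \<zeta> B D)) \<cdot> \<alpha> A B D"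
    by (simp only: hexagon_left assms)
  finally show ?thesis by (simp add: t)
qed

lemma braid_tensor_right:
  assumes "A \<in> Obj C" "B \<in> Obj C" "D \<in> Obj C"
  shows "\<zeta> A (B \<otimes> D) =
    inv (\<alpha> B D A) \<cdot> (\<one> B \<otimes>\<^sub>m \<zeta> A D) \<cdot> \<alpha> B A D \<cdot> (\<zeta> A B \<otimes>\<^sub>m \<one> D) \<cdot> inv (\<alpha> A B D)"
proof -
  note t = assms braid_simps
  have "\<zeta> A (B \<otimes> D) = inv (\<alpha> B D A) \<cdot> (\<alpha> B D A \<cdot> \<zeta> A (B \<otimes> D) \<cdot> \<alpha> A B D) \<cdot> inv (\<alpha> A B D)"
    by (simp add: t assoc_inverse_cancel)
  also have "\<dots> = inv (\<alpha> B D A) \<cdot> ((\<one> B \<otimes>\<^sub>m \<zeta> A D) \<cdot> \<alpha> B A D \<cdot> (\<zeta> A B \<otimes>\<^sub>m \<one> D)) \<cdot> inv (\<alpha> A B D)"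
    by (simp only: hexagon_right assms)
  finally show ?thesis by (simp add: t)
qed

text \<open>
  The arrow \<open>(\<one> D \<otimes>\<^sub>m r I) \<cdot> \<zeta> (I \<otimes> I) D\<close> is computed in two ways: by naturality of the braiding, where
  the triangle produces \<open>l D\<close>, and by the hexagon, where Kelly's identity moves the right unit past
  the braiding and produces \<open>r D \<cdot> \<zeta> I D\<close>. All other factors are invertible.
\<close>

lemma runit_braid:
  assumes D: "D \<in> Obj C"
  shows "r D \<cdot> \<zeta> I D = l D"
proof (rule left_unit_faithful)
  note t = D braid_simps
  show "r D \<cdot> \<zeta> I D \<in> hom C (I \<otimes> D) D" "l D \<in> hom C (I \<otimes> D) D"
    by (auto intro!: homI simp: t)
  have inv: "r (I \<otimes> D) \<cdot> inv (\<alpha> I D I) = \<one> I \<otimes>\<^sub>m r D"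
    by (simp add: runit_tensor[symmetric] assoc_inverse_cancel t)
  have "\<zeta> I D \<cdot> (r I \<otimes>\<^sub>m \<one> D) = (\<one> D \<otimes>\<^sub>m r I) \<cdot> \<zeta> (I \<otimes> I) D"
    by (rule braid_natural) (auto intro!: homI simp: t)
  also have "\<dots> = ((\<one> D \<otimes>\<^sub>m r I) \<cdot> \<alpha> D I I) \<cdot>
      (\<zeta> I D \<otimes>\<^sub>m \<one> I) \<cdot> inv (\<alpha> I D I) \<cdot> (\<one> I \<otimes>\<^sub>m \<zeta> I D) \<cdot> \<alpha> I I D"
    by (simp add: braid_tensor_left t)
  also have "\<dots> = (r (D \<otimes> I) \<cdot> (\<zeta> I D \<otimes>\<^sub>m \<one> I)) \<cdot>
      inv (\<alpha> I D I) \<cdot> (\<one> I \<otimes>\<^sub>m \<zeta> I D) \<cdot> \<alpha> I I D"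
    by (subst runit_tensor) (simp_all add: t)
  also have "r (D \<otimes> I) \<cdot> (\<zeta> I D \<otimes>\<^sub>m \<one> I) = \<zeta> I D \<cdot> r (I \<otimes> D)"
    by (rule runit_natural) (auto intro!: homI simp: t)
  also have "(\<zeta> I D \<cdot> r (I \<otimes> D)) \<cdot> inv (\<alpha> I D I) \<cdot> (\<one> I \<otimes>\<^sub>m \<zeta> I D) \<cdot> \<alpha> I I D =
      \<zeta> I D \<cdot> (r (I \<otimes> D) \<cdot> inv (\<alpha> I D I)) \<cdot> (\<one> I \<otimes>\<^sub>m \<zeta> I D) \<cdot> \<alpha> I I D"
    by (simp add: t)
  also have "\<dots> = \<zeta> I D \<cdot> (\<one> I \<otimes>\<^sub>m (r D \<cdot> \<zeta> I D)) \<cdot> \<alpha> I I D"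
    by (simp add: inv whisker_left_comp t)
  finally have "\<zeta> I D \<cdot> (\<one> I \<otimes>\<^sub>m l D) \<cdot> \<alpha> I I D = \<zeta> I D \<cdot> (\<one> I \<otimes>\<^sub>m (r D \<cdot> \<zeta> I D)) \<cdot> \<alpha> I I D"
    by (simp add: triangle t)
  then have "(\<one> I \<otimes>\<^sub>m l D) \<cdot> \<alpha> I I D = (\<one> I \<otimes>\<^sub>m (r D \<cdot> \<zeta> I D)) \<cdot> \<alpha> I I D"
    by (rule iso_cancel_left[OF braid_iso[of I D], rotated -1]) (auto intro!: homI simp: t)
  then show "\<one> I \<otimes>\<^sub>m (r D \<cdot> \<zeta> I D) = \<one> I \<otimes>\<^sub>m l D"
    by (rule iso_cancel_right[OF assoc_iso[of I I D], rotated -1, symmetric]) (auto intro!: homI simp: t)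
qed

text \<open>
  As in \<open>runit_braid\<close>, now with \<open>(r I \<otimes>\<^sub>m \<one> D) \<cdot> \<zeta> D (I \<otimes> I)\<close> and the other hexagon. Here the triangle
  rewrites the hexagon side, where it makes \<open>l D \<cdot> \<zeta> D I\<close> appear, and Kelly's identity the naturality
  side, where it makes \<open>r D\<close> appear.
\<close>

lemma lunit_braid:
  assumes D: "D \<in> Obj C"
  shows "l D \<cdot> \<zeta> D I = r D"
proof (rule left_unit_faithful)
  note t = D braid_simps
  show "l D \<cdot> \<zeta> D I \<in> hom C (D \<otimes> I) D" "r D \<in> hom C (D \<otimes> I) D"
    by (auto intro!: homI simp: t)
  have inv: "r (D \<otimes> I) \<cdot> inv (\<alpha> D I I) = \<one> D \<otimes>\<^sub>m r I"
    by (simp add: runit_tensor[symmetric] assoc_inverse_cancel t)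
  have "(\<one> I \<otimes>\<^sub>m r D) \<cdot> \<alpha> I D I \<cdot> (\<zeta> D I \<otimes>\<^sub>m \<one> I) \<cdot> inv (\<alpha> D I I) =
      (r (I \<otimes> D) \<cdot> (\<zeta> D I \<otimes>\<^sub>m \<one> I)) \<cdot> inv (\<alpha> D I I)"
    by (simp add: runit_tensor[symmetric] t)
  also have "r (I \<otimes> D) \<cdot> (\<zeta> D I \<otimes>\<^sub>m \<one> I) = \<zeta> D I \<cdot> r (D \<otimes> I)"
    by (rule runit_natural) (auto intro!: homI simp: t)
  also have "\<dots> \<cdot> inv (\<alpha> D I I) = \<zeta> D I \<cdot> (\<one> D \<otimes>\<^sub>m r I)"
    by (simp add: inv t)
  also have "\<dots> = (r I \<otimes>\<^sub>m \<one> D) \<cdot> \<zeta> D (I \<otimes> I)"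
    by (rule braid_natural) (auto intro!: homI simp: t)
  also have "\<dots> = (\<one> I \<otimes>\<^sub>m (l D \<cdot> \<zeta> D I)) \<cdot> \<alpha> I D I \<cdot> (\<zeta> D I \<otimes>\<^sub>m \<one> I) \<cdot> inv (\<alpha> D I I)"
    by (simp add: triangle[symmetric] braid_tensor_right assoc_inverse_cancel whisker_left_comp t)
  finally have eq: "(\<one> I \<otimes>\<^sub>m r D) \<cdot> \<alpha> I D I \<cdot> (\<zeta> D I \<otimes>\<^sub>m \<one> I) \<cdot> inv (\<alpha> D I I) =
      (\<one> I \<otimes>\<^sub>m (l D \<cdot> \<zeta> D I)) \<cdot> \<alpha> I D I \<cdot> (\<zeta> D I \<otimes>\<^sub>m \<one> I) \<cdot> inv (\<alpha> D I I)" .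
  have "((\<one> I \<otimes>\<^sub>m r D) \<cdot> \<alpha> I D I) \<cdot> (\<zeta> D I \<otimes>\<^sub>m \<one> I) =
      ((\<one> I \<otimes>\<^sub>m (l D \<cdot> \<zeta> D I)) \<cdot> \<alpha> I D I) \<cdot> (\<zeta> D I \<otimes>\<^sub>m \<one> I)"
    using arg_cong[OF eq, of "\<lambda>f. f \<cdot> \<alpha> D I I"] by (simp add: assoc_inverse_cancel t)
  then have "(\<one> I \<otimes>\<^sub>m r D) \<cdot> \<alpha> I D I = (\<one> I \<otimes>\<^sub>m (l D \<cdot> \<zeta> D I)) \<cdot> \<alpha> I D I"
    by (rule iso_cancel_right[OF whisker_right_iso[OF braid_iso[of D I], of I], rotated -1])
      (auto intro!: homI simp: t)
  then show "\<one> I \<otimes>\<^sub>m (l D \<cdot> \<zeta> D I) = \<one> I \<otimes>\<^sub>m r D"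
    by (rule iso_cancel_right[OF assoc_iso[of I D I], rotated -1, symmetric]) (auto intro!: homI simp: t)
qed

lemma double_braid_unit:
  assumes D: "D \<in> Obj C"
  shows "\<zeta> D I \<cdot> \<zeta> I D = \<one> (I \<otimes> D)"
proof (rule iso_cancel_left[OF lunit_iso[OF D]])
  note t = D braid_simps
  show "\<zeta> D I \<cdot> \<zeta> I D \<in> hom C (I \<otimes> D) (I \<otimes> D)" "\<one> (I \<otimes> D) \<in> hom C (I \<otimes> D) (I \<otimes> D)"
    by (auto intro!: homI simp: t)
  have "l D \<cdot> \<zeta> D I \<cdot> \<zeta> I D = (l D \<cdot> \<zeta> D I) \<cdot> \<zeta> I D"
    by (simp add: t)
  also have "\<dots> = l D"
    by (simp add: lunit_braid runit_braid D)
  finally show "l D \<cdot> \<zeta> D I \<cdot> \<zeta> I D = l D \<cdot> \<one> (I \<otimes> D)"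
    by (simp add: t)
qed

lemma double_braid_tensor:
  assumes "A \<in> Obj C" "B \<in> Obj C" "D \<in> Obj C"
    and A: "\<zeta> D A \<cdot> \<zeta> A D = \<one> (A \<otimes> D)" and B: "\<zeta> D B \<cdot> \<zeta> B D = \<one> (B \<otimes> D)"
  shows "\<zeta> D (A \<otimes> B) \<cdot> \<zeta> (A \<otimes> B) D = \<one> ((A \<otimes> B) \<otimes> D)"
proof -
  note t = assms(1-3) braid_simps
  have A': "(\<zeta> D A \<otimes>\<^sub>m \<one> B) \<cdot> (\<zeta> A D \<otimes>\<^sub>m \<one> B) = \<one> ((A \<otimes> D) \<otimes> B)"
    using whisker_right_comp[of "\<zeta> A D" "\<zeta> D A" B] by (simp add: A tarr_id t)
  have B': "(\<one> A \<otimes>\<^sub>m \<zeta> D B) \<cdot> (\<one> A \<otimes>\<^sub>m \<zeta> B D) = \<one> (A \<otimes> (B \<otimes> D))"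
    using whisker_left_comp[of "\<zeta> B D" "\<zeta> D B" A] by (simp add: B tarr_id t)
  have "\<zeta> D (A \<otimes> B) \<cdot> \<zeta> (A \<otimes> B) D =
      inv (\<alpha> A B D) \<cdot> (\<one> A \<otimes>\<^sub>m \<zeta> D B) \<cdot> \<alpha> A D B \<cdot> ((\<zeta> D A \<otimes>\<^sub>m \<one> B) \<cdot> (\<zeta> A D \<otimes>\<^sub>m \<one> B)) \<cdot>
        inv (\<alpha> A D B) \<cdot> (\<one> A \<otimes>\<^sub>m \<zeta> B D) \<cdot> \<alpha> A B D"
    by (simp add: braid_tensor_left braid_tensor_right assoc_inverse_cancel t)
  also have "\<dots> = inv (\<alpha> A B D) \<cdot> ((\<one> A \<otimes>\<^sub>m \<zeta> D B) \<cdot> (\<one> A \<otimes>\<^sub>m \<zeta> B D)) \<cdot> \<alpha> A B D"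
    unfolding A' by (simp add: assoc_inverse_cancel t)
  also have "\<dots> = \<one> ((A \<otimes> B) \<otimes> D)"
    unfolding B' by (simp add: assoc_inverse_cancel t)
  finally show ?thesis .
qed

end

notation prod_obj (infixl "\<otimes>\<index>" 70)
notation prod_arr (infixl "\<otimes>\<^sub>m\<index>" 70)

section \<open>Restriction of bimonoidal structures\<close>

lemma full_subcategory_bimonoidal_simps:
  "sum_obj (full_subcategory C S) = sum_obj C"
  "sum_arr (full_subcategory C S) = sum_arr C"
  "zero_obj (full_subcategory C S) = zero_obj C"
  "sum_assoc (full_subcategory C S) = sum_assoc C"
  "sum_lunit (full_subcategory C S) = sum_lunit C"
  "sum_runit (full_subcategory C S) = sum_runit C"
  "sum_sym (full_subcategory C S) = sum_sym C"
  "prod_obj (full_subcategory C S) = prod_obj C"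
  "prod_arr (full_subcategory C S) = prod_arr C"
  "one_obj (full_subcategory C S) = one_obj C"
  "prod_assoc (full_subcategory C S) = prod_assoc C"
  "prod_lunit (full_subcategory C S) = prod_lunit C"
  "prod_runit (full_subcategory C S) = prod_runit C"
  "lnull (full_subcategory C S) = lnull C"
  "rnull (full_subcategory C S) = rnull C"
  "ldistr (full_subcategory C S) = ldistr C"
  "rdistr (full_subcategory C S) = rdistr C"
  by (simp_all add: full_subcategory_def)

lemma full_subcategory_prod_braid: "prod_braid (full_subcategory C S) = prod_braid C"
  by (simp add: full_subcategory_def)

lemma (in bimonoidal_category) full_subcategory_middle_exchange:
  assumes S: "S \<subseteq> Obj C" and T: "\<And>A B. A \<in> S \<Longrightarrow> B \<in> S \<Longrightarrow> A \<oplus> B \<in> S"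
    and W: "W \<in> S" "X \<in> S" "Y \<in> S" "Z \<in> S"
  shows "\<mu>\<^bsub>full_subcategory C S\<^esub> W X Y Z = \<mu> W X Y Z"
proof -
  have "inv\<^bsub>full_subcategory C S\<^esub> (\<alpha>\<^sup>\<oplus> A B D) = inv (\<alpha>\<^sup>\<oplus> A B D)"
    if "A \<in> S" "B \<in> S" "D \<in> S" for A B D
    using that T add.assoc_iso[of A B D]
    by (auto intro!: full_subcategory_inverse_arr iso_arrs_hom simp: subsetD[OF S])
  then show ?thesis
    by (simp add: middle_exchange_def full_subcategory_simps full_subcategory_bimonoidal_simps W T)
qed

text \<open>
  Only the distributors, which are merely monic, and the exchange axiom, whose \<open>\<mu>\<close> contains inverses,
  need more than the corresponding fact of the large category.
\<close>

lemma (in bimonoidal_category) full_subcategory_bimonoidal: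
  assumes S: "S \<subseteq> Obj C" and Z: "\<O> \<in> S" and I: "\<I> \<in> S"
    and P: "\<And>A B. A \<in> S \<Longrightarrow> B \<in> S \<Longrightarrow> A \<oplus> B \<in> S"
    and T: "\<And>A B. A \<in> S \<Longrightarrow> B \<in> S \<Longrightarrow> A \<otimes> B \<in> S"
  shows "bimonoidal_category (full_subcategory C S)"
proof (intro bimonoidal_category.intro bimonoidal_category_axioms.intro,
    unfold full_subcategory_simps full_subcategory_bimonoidal_simps full_subcategory_hom
      full_subcategory_iso_arrs)
  show "\<mu>\<^bsub>full_subcategory C S\<^esub> (A \<otimes> D) (A \<otimes> E) (B \<otimes> D) (B \<otimes> E) \<cdot>
      (\<delta>\<^sup>l A D E \<oplus>\<^sub>m \<delta>\<^sup>l B D E) \<cdot> \<delta>\<^sup>r A B (D \<oplus> E) =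
      (\<delta>\<^sup>r A B D \<oplus>\<^sub>m \<delta>\<^sup>r A B E) \<cdot> \<delta>\<^sup>l (A \<oplus> B) D E"
    if "A \<in> S" "B \<in> S" "D \<in> S" "E \<in> S" for A B D E
    using that lrdistr_exchange[of A B D E]
    by (simp add: full_subcategory_middle_exchange[OF S P] T subsetD[OF S])
  show "\<delta>\<^sup>l A B D \<in> mono_arrs (full_subcategory C S) (A \<otimes> (B \<oplus> D)) (A \<otimes> B \<oplus> A \<otimes> D)"
    if "A \<in> S" "B \<in> S" "D \<in> S" for A B D
    using that S by (intro full_subcategory_mono_arrs ldistr_mono T P) auto
  show "\<delta>\<^sup>r A B D \<in> mono_arrs (full_subcategory C S) ((A \<oplus> B) \<otimes> D) (A \<otimes> D \<oplus> B \<otimes> D)"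
    if "A \<in> S" "B \<in> S" "D \<in> S" for A B D
    using that S by (intro full_subcategory_mono_arrs rdistr_mono T P) auto
qed ((elim conjE)?; (intro conjI)?;
    (assumption | (simp add: Z I P T; fail) |
      (rule add.full_subcategory_symmetric mult.full_subcategory_monoidal lnull_iso
          lnull_natural rnull_iso rnull_natural ldistr_natural rdistr_natural ldistr_sym
          rdistr_sym rdistr_sum_assoc ldistr_sum_assoc ldistr_prod_assoc rdistr_prod_assoc
          lrdistr_prod_assoc null_zero lnull_sum rnull_sum lnull_one rnull_one lnull_prod
          lrnull_prod rnull_prod ldistr_zero_left rdistr_zero_left ldistr_zero_right
          rdistr_zero_right ldistr_one rdistr_one;
        (assumption | simp add: Z I P T S subsetD[OF S]; fail))))+

lemma (in braided_bimonoidal_category) full_subcategory_braided_bimonoidal: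
  assumes S: "S \<subseteq> Obj C" and Z: "\<O> \<in> S" and I: "\<I> \<in> S"
    and P: "\<And>A B. A \<in> S \<Longrightarrow> B \<in> S \<Longrightarrow> A \<oplus> B \<in> S"
    and T: "\<And>A B. A \<in> S \<Longrightarrow> B \<in> S \<Longrightarrow> A \<otimes> B \<in> S"
  shows "braided_bimonoidal_category (full_subcategory C S)"
proof (intro braided_bimonoidal_category.intro full_subcategory_bimonoidal assms
    braided_bimonoidal_category_axioms.intro,
    unfold full_subcategory_simps full_subcategory_bimonoidal_simps full_subcategory_prod_braid)
qed ((elim conjE)?; (intro conjI)?;
    (assumption | (simp add: I T; fail) |
      (rule mult.full_subcategory_braided ldistr_braid rdistr_braid lnull_braid rnull_braid;
        (assumption | simp add: I T S subsetD[OF S]; fail))))+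

section \<open>Closure of the symmetric center\<close>

context braided_bimonoidal_category
begin

lemma double_braid_zero:
  assumes D: "D \<in> Obj C"
  shows "\<zeta>\<^sup>\<otimes> D \<O> \<cdot> \<zeta>\<^sup>\<otimes> \<O> D = \<one> (\<O> \<otimes> D)"
proof (rule add.iso_cancel_left[OF lnull_iso[OF D]])
  note Z = add.unit_closed
  note t = mult.braid_typing[OF D Z] mult.braid_typing[OF Z D]
    lnull_iso[OF D, THEN iso_arrs_hom]
  show "\<one> (\<O> \<otimes> D) \<in> hom C (\<O> \<otimes> D) (\<O> \<otimes> D)"
    by (simp add: add.id_closed mult.tobj_closed D Z)
  show "\<zeta>\<^sup>\<otimes> D \<O> \<cdot> \<zeta>\<^sup>\<otimes> \<O> D \<in> hom C (\<O> \<otimes> D) (\<O> \<otimes> D)"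
    using t(2,1) by (rule add.comp_closed)
  have "\<lambda>\<^sup>\<bullet> D \<cdot> \<zeta>\<^sup>\<otimes> D \<O> \<cdot> \<zeta>\<^sup>\<otimes> \<O> D = (\<lambda>\<^sup>\<bullet> D \<cdot> \<zeta>\<^sup>\<otimes> D \<O>) \<cdot> \<zeta>\<^sup>\<otimes> \<O> D"
    using add.comp_assoc[OF t(2,1,3)] by simp
  also have "\<dots> = \<lambda>\<^sup>\<bullet> D \<cdot> \<one> (\<O> \<otimes> D)"
    by (simp add: lnull_braid rnull_braid D add.id_right[OF t(3)])
  finally show "\<lambda>\<^sup>\<bullet> D \<cdot> \<zeta>\<^sup>\<otimes> D \<O> \<cdot> \<zeta>\<^sup>\<otimes> \<O> D = \<lambda>\<^sup>\<bullet> D \<cdot> \<one> (\<O> \<otimes> D)" .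
qed

lemma double_braid_sum:
  assumes o: "A \<in> Obj C" "B \<in> Obj C" "D \<in> Obj C"
    and A: "\<zeta>\<^sup>\<otimes> D A \<cdot> \<zeta>\<^sup>\<otimes> A D = \<one> (A \<otimes> D)" and B: "\<zeta>\<^sup>\<otimes> D B \<cdot> \<zeta>\<^sup>\<otimes> B D = \<one> (B \<otimes> D)"
  shows "\<zeta>\<^sup>\<otimes> D (A \<oplus> B) \<cdot> \<zeta>\<^sup>\<otimes> (A \<oplus> B) D = \<one> ((A \<oplus> B) \<otimes> D)"
proof (rule add.mono_cancel[OF rdistr_mono[OF o]])
  note t = o mult.braid_simps add.tobj_closed add.tarr_typing
    ldistr_mono[THEN mono_arrs_hom, THEN in_homD(1)] ldistr_mono[THEN mono_arrs_hom, THEN in_homD(2)]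
    ldistr_mono[THEN mono_arrs_hom, THEN in_homD(3)]
    rdistr_mono[THEN mono_arrs_hom, THEN in_homD(1)] rdistr_mono[THEN mono_arrs_hom, THEN in_homD(2)]
    rdistr_mono[THEN mono_arrs_hom, THEN in_homD(3)]
  show "\<zeta>\<^sup>\<otimes> D (A \<oplus> B) \<cdot> \<zeta>\<^sup>\<otimes> (A \<oplus> B) D \<in> hom C ((A \<oplus> B) \<otimes> D) ((A \<oplus> B) \<otimes> D)"
    "\<one> ((A \<oplus> B) \<otimes> D) \<in> hom C ((A \<oplus> B) \<otimes> D) ((A \<oplus> B) \<otimes> D)"
    by (auto intro!: homI simp: t)
  have "\<delta>\<^sup>r A B D \<cdot> \<zeta>\<^sup>\<otimes> D (A \<oplus> B) \<cdot> \<zeta>\<^sup>\<otimes> (A \<oplus> B) D =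
      (\<delta>\<^sup>r A B D \<cdot> \<zeta>\<^sup>\<otimes> D (A \<oplus> B)) \<cdot> \<zeta>\<^sup>\<otimes> (A \<oplus> B) D"
    by (simp add: t)
  also have "\<dots> = (\<zeta>\<^sup>\<otimes> D A \<oplus>\<^sub>m \<zeta>\<^sup>\<otimes> D B) \<cdot> (\<delta>\<^sup>l D A B \<cdot> \<zeta>\<^sup>\<otimes> (A \<oplus> B) D)"
    by (subst rdistr_braid) (simp_all add: t)
  also have "\<dots> = ((\<zeta>\<^sup>\<otimes> D A \<oplus>\<^sub>m \<zeta>\<^sup>\<otimes> D B) \<cdot> (\<zeta>\<^sup>\<otimes> A D \<oplus>\<^sub>m \<zeta>\<^sup>\<otimes> B D)) \<cdot> \<delta>\<^sup>r A B D"
    by (subst ldistr_braid) (simp_all add: t)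
  also have "(\<zeta>\<^sup>\<otimes> D A \<oplus>\<^sub>m \<zeta>\<^sup>\<otimes> D B) \<cdot> (\<zeta>\<^sup>\<otimes> A D \<oplus>\<^sub>m \<zeta>\<^sup>\<otimes> B D) =
      (\<zeta>\<^sup>\<otimes> D A \<cdot> \<zeta>\<^sup>\<otimes> A D) \<oplus>\<^sub>m (\<zeta>\<^sup>\<otimes> D B \<cdot> \<zeta>\<^sup>\<otimes> B D)"
    by (rule add.tarr_comp[symmetric]) (auto intro!: mult.braid_typing o)
  also have "\<dots> \<cdot> \<delta>\<^sup>r A B D = \<delta>\<^sup>r A B D \<cdot> \<one> ((A \<oplus> B) \<otimes> D)"
    by (simp add: A B add.tarr_id t)
  finally show "\<delta>\<^sup>r A B D \<cdot> \<zeta>\<^sup>\<otimes> D (A \<oplus> B) \<cdot> \<zeta>\<^sup>\<otimes> (A \<oplus> B) D =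
      \<delta>\<^sup>r A B D \<cdot> \<one> ((A \<oplus> B) \<otimes> D)" .
qed

end

theorem mainTheorem8:
  fixes C :: "('o, 'm) braided_bimonoidal_data"
  assumes "braided_bimonoidal_category C"
  shows "symmetric_bimonoidal_category (bimonoidal_symmetric_center C)"
proof -
  interpret braided_bimonoidal_category C by fact
  let ?S = "{A \<in> Obj C. \<forall>B \<in> Obj C. \<zeta>\<^sup>\<otimes>\<^bsub>C\<^esub> B A \<cdot>\<^bsub>C\<^esub> \<zeta>\<^sup>\<otimes>\<^bsub>C\<^esub> A B = \<one>\<^bsub>C\<^esub> (A \<otimes>\<^bsub>C\<^esub> B)}"
  have "braided_bimonoidal_category (full_subcategory C ?S)"
    by (rule full_subcategory_braided_bimonoidal)
      (auto simp: add.unit_closed mult.unit_closed add.tobj_closed mult.tobj_closed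
        double_braid_zero double_braid_sum mult.double_braid_unit mult.double_braid_tensor)
  then have "symmetric_bimonoidal_category (full_subcategory C ?S)"
    by (intro symmetric_bimonoidal_category.intro symmetric_bimonoidal_category_axioms.intro)
      (auto simp: full_subcategory_simps full_subcategory_bimonoidal_simps
        full_subcategory_prod_braid)
  then show ?thesis
    by (simp only: bimonoidal_symmetric_center_def)
qed

end
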